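(* The alternating sum of the digits of a nonnegative integer in base $3/2$, read from right to left, has the same remainder modulo $5$ as the integer itself. That is, if $d_{k-1}\cdots d_1d_0$ is the base-$3/2$ representation of a nonnegative integer $n$, then $\sum_{i=0}^{k-1}(-1)^i d_i\equiv n\pmod 5$.
   Context: The base-$3/2$ representation of a nonnegative integer $n$ is obtained as follows ("exploding dots"): place $n$ dots in the rightmost box of a row of boxes extending infinitely to the left; whenever a box contains at least three dots, remove three dots from it and place two dots in the box immediately to its left; continue until every box contains $0$, $1$ or $2$ dots. The numbers of dots, read from left to right starting with the leftmost nonempty box, are the digits of $n$ in base $3/2$ (the representation of $0$ is $0$). If the digits are $d_{k-1}\cdots d_1d_0$ then $n=\sum_i d_i(3/2)^i$. *)

theory Defs
  imports "HOL-Number_Theory.Cong"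
begin

text \<open>A configuration assigns to each box its number of dots. Boxes are numbered from the
  right, the rightmost one being box 0.\<close>

type_synonym config = "nat \<Rightarrow> nat"

definition initial :: "nat \<Rightarrow> config" where
  "initial n = (\<lambda>_. 0)(0 := n)"

inductive explosion :: "config \<Rightarrow> config \<Rightarrow> bool" where
  "c i \<ge> 3 \<Longrightarrow> explosion c (c(i := c i - 3, Suc i := c (Suc i) + 2))"

definition stable :: "config \<Rightarrow> bool" where
  "stable c \<longleftrightarrow> (\<forall>i. c i \<in> {0, 1, 2})"

definition final :: "nat \<Rightarrow> config" where
  "final n = (THE c. explosion\<^sup>*\<^sup>* (initial n) c \<and> stable c)"

text \<open>The digits are listed with the rightmost one first, so that \<open>base32_digits n ! i\<close> is the
  coefficient of \<open>(3/2)^i\<close>.\<close>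

definition base32_digits :: "nat \<Rightarrow> nat list" where
  "base32_digits n =
     (if n = 0 then [0] else map (final n) [0..<Suc (Max {i. final n i \<noteq> 0})])"

text \<open>The process always ends, in a configuration that does not depend on the order of the
  explosions, so \<open>final\<close> and \<open>base32_digits\<close> are well defined.\<close>

definition supp :: "config \<Rightarrow> nat set" where
  "supp c = {i. c i \<noteq> 0}"

lemma explosion_finite_supp:
  assumes "explosion c c'" "finite (supp c)"
  shows "finite (supp c')"
  using assms(1)
proof cases
  case (1 i)
  then have "supp c' \<subseteq> insert (Suc i) (supp c)"
    by (auto simp: supp_def split: if_splits)
  then show ?thesis
    using assms(2) finite_subset by blast
qed

lemma explosion_sum_less:
  assumes "explosion c c'" "finite (supp c)"
  shows "sum c' (supp c') < sum c (supp c)"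
  using assms(1)
proof cases
  case (1 i)
  let ?A = "insert i (insert (Suc i) (supp c))"
  let ?B = "supp c - {i, Suc i}"
  have fin: "finite ?A" "finite ?B"
    using assms(2) by auto
  have A: "?A = insert i (insert (Suc i) ?B)" by auto
  have split: "sum f ?A = f i + f (Suc i) + sum f ?B" for f :: config
    unfolding A using fin(2) by (simp add: add.assoc)
  have "sum c' (supp c') = sum c' ?A"
    by (rule sum.mono_neutral_left) (use fin 1 in \<open>auto simp: supp_def split: if_splits\<close>)
  also have "\<dots> = c i - 3 + (c (Suc i) + 2) + sum c' ?B"
    using split[of c'] 1 by simp
  also have "sum c' ?B = sum c ?B"
    by (rule sum.cong) (use 1 in auto)
  also have "c i - 3 + (c (Suc i) + 2) + sum c ?B < sum c ?A"
    using split[of c] 1 by simp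
  also have "sum c ?A = sum c (supp c)"
    by (rule sum.mono_neutral_right) (use fin in \<open>auto simp: supp_def\<close>)
  finally show ?thesis .
qed

lemma explosion_diamond:
  assumes "explosion c a" "explosion c b" "a \<noteq> b"
  obtains d where "explosion a d" "explosion b d"
proof -
  obtain i where i: "c i \<ge> 3" "a = c(i := c i - 3, Suc i := c (Suc i) + 2)"
    using assms(1) by (auto elim: explosion.cases)
  obtain j where j: "c j \<ge> 3" "b = c(j := c j - 3, Suc j := c (Suc j) + 2)"
    using assms(2) by (auto elim: explosion.cases)
  have "i \<noteq> j" using i j assms(3) by auto
  have "explosion a (a(j := a j - 3, Suc j := a (Suc j) + 2))"
    by (rule explosion.intros) (use i j \<open>i \<noteq> j\<close> in auto)
  moreover have "explosion b (b(i := b i - 3, Suc i := b (Suc i) + 2))"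
    by (rule explosion.intros) (use i j \<open>i \<noteq> j\<close> in auto)
  moreover have "a(j := a j - 3, Suc j := a (Suc j) + 2) = b(i := b i - 3, Suc i := b (Suc i) + 2)"
    using i j \<open>i \<noteq> j\<close> by (auto simp: fun_eq_iff)
  ultimately show ?thesis using that by metis
qed

lemma stable_iff: "stable c \<longleftrightarrow> (\<nexists>c'. explosion c c')"
proof -
  have "c i \<in> {0, 1, 2} \<longleftrightarrow> \<not> c i \<ge> 3" for i by auto
  then show ?thesis
    unfolding stable_def by (blast elim: explosion.cases intro: explosion.intros)
qed

lemma ex1_stable:
  assumes "finite (supp c)"
  shows "\<exists>!s. explosion\<^sup>*\<^sup>* c s \<and> stable s"
  using assms
proof (induction "sum c (supp c)" arbitrary: c rule: less_induct)
  case less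
  have IH: "\<exists>!s. explosion\<^sup>*\<^sup>* c' s \<and> stable s" if "explosion c c'" for c'
    using less.hyps explosion_sum_less explosion_finite_supp that less.prems by blast
  show ?case
  proof (cases "stable c")
    case True
    then show ?thesis
      by (metis converse_rtranclpE rtranclp.rtrancl_refl stable_iff)
  next
    case False
    then obtain a where a: "explosion c a" using stable_iff by blast
    then obtain s where s: "explosion\<^sup>*\<^sup>* a s" "stable s" using IH by blast
    show ?thesis
    proof (rule ex1I[of _ s])
      show "explosion\<^sup>*\<^sup>* c s \<and> stable s"
        using a s by (meson converse_rtranclp_into_rtranclp)
    next
      fix t assume t: "explosion\<^sup>*\<^sup>* c t \<and> stable t"
      then obtain b where b: "explosion c b" "explosion\<^sup>*\<^sup>* b t"
        using False by (metis converse_rtranclpE)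
      show "t = s"
      proof (cases "a = b")
        case True
        then show ?thesis using IH[OF a] s b t by blast
      next
        case neq: False
        obtain d where d: "explosion a d" "explosion b d"
          using explosion_diamond[OF a b(1) neq] by blast
        have fin: "finite (supp a)" "sum a (supp a) < sum c (supp c)"
          using a explosion_finite_supp explosion_sum_less less.prems by blast+
        then have "finite (supp d)" "sum d (supp d) < sum c (supp c)"
          using d(1) explosion_finite_supp explosion_sum_less by fastforce+
        then obtain u where u: "explosion\<^sup>*\<^sup>* d u" "stable u"
          using less.hyps by blast
        then have "explosion\<^sup>*\<^sup>* a u" "explosion\<^sup>*\<^sup>* b u"
          using d by (meson converse_rtranclp_into_rtranclp)+
        then show ?thesis
          using IH[OF a] IH[OF b(1)] s t b(2) u by metis
      qed
    qed
  qed
qed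

lemma finite_supp_initial: "finite (supp (initial n))"
  by (rule finite_subset[of _ "{0}"]) (auto simp: supp_def initial_def)

lemma final_reached: "explosion\<^sup>*\<^sup>* (initial n) (final n)"
  and final_stable: "stable (final n)"
  using theI'[OF ex1_stable[OF finite_supp_initial]] unfolding final_def by blast+

lemma final_finite: "finite {i. final n i \<noteq> 0}"
proof -
  have "finite (supp c)" if "explosion\<^sup>*\<^sup>* (initial n) c" for c
    using that by induction (auto simp: finite_supp_initial explosion_finite_supp)
  then show ?thesis using final_reached by (simp add: supp_def)
qed

lemma final_nonempty:
  assumes "n \<noteq> 0"
  shows "{i. final n i \<noteq> 0} \<noteq> {}"
proof -
  have "\<exists>i. c i \<noteq> 0" if "explosion\<^sup>*\<^sup>* (initial n) c" for c
    using that
  proof induction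
    case base
    then show ?case using assms by (auto simp: initial_def)
  next
    case (step b c)
    from step.hyps(2) show ?case
    proof cases
      case (1 i)
      then show ?thesis by (intro exI[of _ "Suc i"]) simp
    qed
  qed
  then show ?thesis using final_reached by blast
qed

end

theory Submission
  imports Defs
begin

text \<open>
  The reason is that the base behaves like \<open>-1\<close> modulo \<open>5\<close>: since \<open>3 \<equiv> -2\<close>, we have
  \<open>3/2 \<equiv> -1\<close>. So weigh the dots in box \<open>i\<close> by \<open>(-1)^i\<close>. An explosion in box \<open>i\<close> trades three dots of
  weight \<open>(-1)^i\<close> for two of weight \<open>-(-1)^i\<close> and lowers the total by \<open>5 (-1)^i\<close>; hence the total
  weight modulo \<open>5\<close> is an invariant of the process. It is \<open>n\<close> at the start and the alternating
  digit sum at the end.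
\<close>

definition alt_weight :: "config \<Rightarrow> int" where
  "alt_weight c = (\<Sum>i\<in>supp c. (- 1) ^ i * int (c i))"

text \<open>Boxes that are empty in one configuration need not be empty in the next, so weights are
  compared over a common finite set of boxes.\<close>

lemma alt_weight_superset:
  assumes "finite A" "supp c \<subseteq> A"
  shows "alt_weight c = (\<Sum>i\<in>A. (- 1) ^ i * int (c i))"
  unfolding alt_weight_def
  by (rule sum.mono_neutral_left) (use assms in \<open>auto simp: supp_def\<close>)

lemma explosion_alt_weight_cong:
  assumes "explosion c c'" "finite (supp c)"
  shows "[alt_weight c' = alt_weight c] (mod 5)"
  using assms(1)
proof cases
  case (1 i)
  let ?B = "supp c - {i, Suc i}"
  let ?A = "insert i (insert (Suc i) ?B)"
  have fin: "finite ?B" using assms(2) by auto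
  have split: "alt_weight d = (- 1) ^ i * (int (d i) - int (d (Suc i)))
                 + (\<Sum>k\<in>?B. (- 1) ^ k * int (d k))" if "supp d \<subseteq> ?A" for d
    using alt_weight_superset[OF _ that] fin by (simp add: algebra_simps)
  have "supp c \<subseteq> ?A" "supp c' \<subseteq> ?A"
    using 1 by (auto simp: supp_def split: if_splits)
  moreover have "(\<Sum>k\<in>?B. (- 1) ^ k * int (c' k)) = (\<Sum>k\<in>?B. (- 1) ^ k * int (c k))"
    by (rule sum.cong) (use 1 in auto)
  ultimately have "alt_weight c - alt_weight c' = 5 * (- 1) ^ i"
    using split[of c] split[of c'] 1 by (simp add: algebra_simps of_nat_diff)
  then show ?thesis
    by (metis cong_iff_dvd_diff cong_sym dvd_triv_left)
qed

lemma explosions_alt_weight_cong: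
  assumes "explosion\<^sup>*\<^sup>* c d" "finite (supp c)"
  shows "[alt_weight d = alt_weight c] (mod 5)"
  using assms
proof (induction rule: converse_rtranclp_induct)
  case (step b c)
  then show ?case
    using explosion_alt_weight_cong explosion_finite_supp cong_trans by blast
qed simp

lemma alt_weight_initial: "alt_weight (initial n) = int n"
  by (subst alt_weight_superset[of "{0}"]) (auto simp: supp_def initial_def)

lemma alternating_digit_sum:
  "(\<Sum>i<length (base32_digits n). (- 1) ^ i * int (base32_digits n ! i)) = alt_weight (final n)"
proof (cases "n = 0")
  case True
  \<comment> \<open>The single digit \<open>0\<close> of the number \<open>0\<close> is listed by convention, so it has to be matched
    separately with the final configuration, which has no dots.\<close>
  have "stable (initial 0)" by (simp add: stable_def initial_def)
  then have "final 0 = initial 0"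
    using final_reached[of 0] by (metis converse_rtranclpE stable_iff)
  then show ?thesis
    using True by (simp add: base32_digits_def alt_weight_initial)
next
  case False
  let ?k = "Suc (Max {i. final n i \<noteq> 0})"
  have digits: "base32_digits n = map (final n) [0..<?k]"
    using False by (simp add: base32_digits_def)
  have "supp (final n) \<subseteq> {..<?k}"
    using Max_ge[OF final_finite[of n]] by (auto simp: supp_def less_Suc_eq_le)
  then have "alt_weight (final n) = (\<Sum>i<?k. (- 1) ^ i * int (final n i))"
    by (intro alt_weight_superset) auto
  also have "\<dots> = (\<Sum>i<?k. (- 1) ^ i * int (base32_digits n ! i))"
    unfolding digits by (rule sum.cong) (auto simp del: upt_Suc)
  finally show ?thesis
    by (simp add: digits del: upt_Suc)
qed

theorem lemma10:
  fixes n :: nat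
  shows "[(\<Sum>i<length (base32_digits n). (- 1) ^ i * int (base32_digits n ! i)) = int n] (mod 5)"
  using explosions_alt_weight_cong[OF final_reached finite_supp_initial]
  by (simp add: alternating_digit_sum alt_weight_initial)

end
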